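(* Consider the single load minimal cache demand problem with $c$ cores and total cache $K$. Call a job large if $a_j>\frac13$ and small otherwise. Algorithm $A_{4/3}$: build a graph $G$ with one vertex of weight $a_j$ for each large job $j$, plus artificial vertices of weight $0$ so that $G$ has exactly $2c$ vertices (fail if there are more than $2c$ large jobs), with an edge between two distinct vertices iff the sum of their weights is at most $1$; find a dominant perfect matching $Q$ of $G$ (fail if none is found) and, for each edge of $Q$, put the large jobs corresponding to its endpoints on a common core (different edges on different cores). Then process the small jobs in non-increasing order of cache demand, assigning them to cores taken in non-decreasing order of their current load (sum of large job loads), continuing on a core until its load exceeds $1$ and then moving to the next; allocate to each core the maximum cache demand of its jobs; fail if more than $c$ cores or more than $3K$ cache are used. If there is a solution assigning the jobs to $c$ cores with makespan at most $1$ and using $K$ cache, then $A_{4/3}$ assigns the jobs to $c$ cores with makespan at most $\frac43$ and uses at most $3K$ cache.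
   Context: Single load minimal cache demand problem: each job $j$ has a load $a_j>0$ and a minimal cache demand $x_j\ge0$. A solution is a cache partition $p$ giving $p(i)\ge0$ cache to each core (cache used $=\sum_ip(i)$) and an assignment $S$ of jobs to cores with $p(S(j))\ge x_j$ for every job; the makespan is the maximum over cores of the sum of $a_j$ of the jobs on the core. For a graph with weighted vertices, the weight of an edge is the sum of the weights of its endpoints; ties between edges of equal weight are broken by a fixed arbitrary order on the edges, so that for a perfect matching $A$ with $c$ edges the $i$-th heaviest edge $A_i$ is well defined. A perfect matching $A$ dominates a perfect matching $B$ if $\sum_{i=1}^xw(A_i)\ge\sum_{i=1}^xw(B_i)$ for all $x\in\{1,\dots,c\}$; a dominant perfect matching is one that dominates every perfect matching. *)

theory Defs
  imports Complex_Main
begin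

section \<open>Single load minimal cache demand\<close>

text \<open>Jobs are the elements of a finite set \<open>J\<close>; job \<open>j\<close> has load \<open>a j\<close> and minimal cache
  demand \<open>x j\<close>. The \<open>c\<close> cores are the numbers below \<open>c\<close>.\<close>

definition cache_instance :: "'j set \<Rightarrow> ('j \<Rightarrow> real) \<Rightarrow> ('j \<Rightarrow> real) \<Rightarrow> bool" where
  "cache_instance J a x \<longleftrightarrow> finite J \<and> (\<forall>j\<in>J. a j > 0 \<and> x j \<ge> 0)"

definition is_solution ::
    "'j set \<Rightarrow> ('j \<Rightarrow> real) \<Rightarrow> nat \<Rightarrow> ('j \<Rightarrow> nat) \<Rightarrow> (nat \<Rightarrow> real) \<Rightarrow> bool" where
  "is_solution J x c S p \<longleftrightarrow>
     (\<forall>i<c. p i \<ge> 0) \<and> (\<forall>j\<in>J. S j < c \<and> p (S j) \<ge> x j)"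

definition cache_used :: "nat \<Rightarrow> (nat \<Rightarrow> real) \<Rightarrow> real" where
  "cache_used c p = (\<Sum>i<c. p i)"

definition core_load :: "'j set \<Rightarrow> ('j \<Rightarrow> real) \<Rightarrow> ('j \<Rightarrow> nat) \<Rightarrow> nat \<Rightarrow> real" where
  "core_load J a S i = (\<Sum>j | j \<in> J \<and> S j = i. a j)"

text \<open>Loads are nonnegative, so the inserted \<open>0\<close> only serves to give \<open>Max\<close> a nonempty argument
  when \<open>c = 0\<close>; likewise in \<open>max_demand\<close> for a core without jobs.\<close>

definition makespan :: "'j set \<Rightarrow> ('j \<Rightarrow> real) \<Rightarrow> nat \<Rightarrow> ('j \<Rightarrow> nat) \<Rightarrow> real" where
  "makespan J a c S = Max (insert 0 (core_load J a S ` {..<c}))"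

definition max_demand :: "'j set \<Rightarrow> ('j \<Rightarrow> real) \<Rightarrow> ('j \<Rightarrow> nat) \<Rightarrow> nat \<Rightarrow> real" where
  "max_demand J x S i = Max (insert 0 (x ` {j \<in> J. S j = i}))"


section \<open>Dominant perfect matchings\<close>

definition edge_weight :: "('v \<Rightarrow> real) \<Rightarrow> 'v set \<Rightarrow> real" where
  "edge_weight w e = (\<Sum>v\<in>e. w v)"

definition perfect_matching :: "'v set \<Rightarrow> 'v set set \<Rightarrow> 'v set set \<Rightarrow> bool" where
  "perfect_matching V E M \<longleftrightarrow> M \<subseteq> E \<and> (\<forall>v\<in>V. \<exists>!e. e \<in> M \<and> v \<in> e)"

text \<open>The relation \<open>r\<close> is the fixed order on the edges that breaks ties.\<close>

definition heavier :: "('v \<Rightarrow> real) \<Rightarrow> 'v set rel \<Rightarrow> 'v set \<Rightarrow> 'v set \<Rightarrow> bool" where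
  "heavier w r e f \<longleftrightarrow> edge_weight w e > edge_weight w f \<or>
     edge_weight w e = edge_weight w f \<and> e \<noteq> f \<and> (e, f) \<in> r"

text \<open>Counting starts at \<open>1\<close>: the \<open>i\<close>-th heaviest edge has \<open>i - 1\<close> edges before it.\<close>

definition nth_heaviest ::
    "('v \<Rightarrow> real) \<Rightarrow> 'v set rel \<Rightarrow> 'v set set \<Rightarrow> nat \<Rightarrow> 'v set" where
  "nth_heaviest w r A i = (THE e. e \<in> A \<and> Suc (card {f \<in> A. heavier w r f e}) = i)"

definition dominates ::
    "('v \<Rightarrow> real) \<Rightarrow> 'v set rel \<Rightarrow> 'v set set \<Rightarrow> 'v set set \<Rightarrow> bool" where
  "dominates w r A B \<longleftrightarrow>
     (\<forall>k\<in>{1..card A}. (\<Sum>i=1..k. edge_weight w (nth_heaviest w r A i))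
                      \<ge> (\<Sum>i=1..k. edge_weight w (nth_heaviest w r B i)))"

definition dominant_perfect_matching ::
    "'v set \<Rightarrow> 'v set set \<Rightarrow> ('v \<Rightarrow> real) \<Rightarrow> 'v set rel \<Rightarrow> 'v set set \<Rightarrow> bool" where
  "dominant_perfect_matching V E w r A \<longleftrightarrow>
     perfect_matching V E A \<and> (\<forall>B. perfect_matching V E B \<longrightarrow> dominates w r A B)"


section \<open>The algorithm\<close>

definition large_jobs :: "'j set \<Rightarrow> ('j \<Rightarrow> real) \<Rightarrow> 'j set" where
  "large_jobs J a = {j \<in> J. a j > 1/3}"

definition small_jobs :: "'j set \<Rightarrow> ('j \<Rightarrow> real) \<Rightarrow> 'j set" where
  "small_jobs J a = J - large_jobs J a"

datatype 'j vertex = Job 'j | Artificial nat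

primrec vertex_weight :: "('j \<Rightarrow> real) \<Rightarrow> 'j vertex \<Rightarrow> real" where
  "vertex_weight a (Job j) = a j"
| "vertex_weight a (Artificial n) = 0"

definition G_verts :: "'j set \<Rightarrow> ('j \<Rightarrow> real) \<Rightarrow> nat \<Rightarrow> 'j vertex set" where
  "G_verts J a c =
     Job ` large_jobs J a \<union> Artificial ` {..<2 * c - card (large_jobs J a)}"

definition G_edges :: "'j set \<Rightarrow> ('j \<Rightarrow> real) \<Rightarrow> nat \<Rightarrow> 'j vertex set set" where
  "G_edges J a c = {{u, v} | u v. u \<in> G_verts J a c \<and> v \<in> G_verts J a c \<and> u \<noteq> v \<and>
                                  vertex_weight a u + vertex_weight a v \<le> 1}"

text \<open>\<open>place_small a ld cs js S\<close> extends the assignment \<open>S\<close> by the jobs \<open>js\<close>, taken in this order,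
  on the cores \<open>cs\<close>, taken in this order, where \<open>ld\<close> gives the current loads. The result is
  \<open>None\<close> if a job is left when all cores are used up.\<close>

fun place_small :: "('j \<Rightarrow> real) \<Rightarrow> (nat \<Rightarrow> real) \<Rightarrow> nat list \<Rightarrow> 'j list \<Rightarrow> ('j \<Rightarrow> nat)
    \<Rightarrow> ('j \<Rightarrow> nat) option" where
  "place_small a ld cs [] S = Some S"
| "place_small a ld [] (j # js) S = None"
| "place_small a ld (i # cs) (j # js) S =
     (if ld i > 1 then place_small a ld cs (j # js) S
      else place_small a (ld(i := ld i + a j)) (i # cs) js (S(j := i)))"

text \<open>\<open>A43_place J a x c r res\<close>: some choice of a dominant perfect matching \<open>Q\<close>, of distinct cores
  \<open>\<sigma> e\<close> for its edges \<open>e\<close>, and of the orders \<open>js\<close> of the small jobs and \<open>cs\<close> of the cores leads to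
  the result \<open>res\<close> of placing the small jobs. The values of \<open>S\<^sub>0\<close> matter on large jobs only.\<close>

inductive A43_place :: "'j set \<Rightarrow> ('j \<Rightarrow> real) \<Rightarrow> ('j \<Rightarrow> real) \<Rightarrow> nat \<Rightarrow> 'j vertex set rel
    \<Rightarrow> ('j \<Rightarrow> nat) option \<Rightarrow> bool"
  for J a x c r where
  "\<lbrakk> card (large_jobs J a) \<le> 2 * c;
     dominant_perfect_matching (G_verts J a c) (G_edges J a c) (vertex_weight a) r Q;
     inj_on \<sigma> Q; \<sigma> ` Q \<subseteq> {..<c};
     \<forall>e\<in>Q. \<forall>j. Job j \<in> e \<longrightarrow> S\<^sub>0 j = \<sigma> e;
     ld = core_load (large_jobs J a) a S\<^sub>0;
     distinct js; set js = small_jobs J a; sorted_wrt (\<lambda>j k. x j \<ge> x k) js;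
     distinct cs; set cs = {..<c}; sorted_wrt (\<lambda>i k. ld i \<le> ld k) cs \<rbrakk>
   \<Longrightarrow> A43_place J a x c r (place_small a ld cs js S\<^sub>0)"

text \<open>The possible outcomes of the algorithm: \<open>None\<close> is failure, \<open>Some (S, p)\<close> is an assignment
  together with a cache partition.\<close>

inductive A43 :: "'j set \<Rightarrow> ('j \<Rightarrow> real) \<Rightarrow> ('j \<Rightarrow> real) \<Rightarrow> nat \<Rightarrow> real \<Rightarrow> 'j vertex set rel
    \<Rightarrow> (('j \<Rightarrow> nat) \<times> (nat \<Rightarrow> real)) option \<Rightarrow> bool"
  for J a x c K r where
  too_many_large:
    "card (large_jobs J a) > 2 * c \<Longrightarrow> A43 J a x c K r None"
| no_matching:
    "\<lbrakk> card (large_jobs J a) \<le> 2 * c;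
       \<nexists>Q. dominant_perfect_matching (G_verts J a c) (G_edges J a c) (vertex_weight a) r Q \<rbrakk>
     \<Longrightarrow> A43 J a x c K r None"
| too_many_cores:
    "A43_place J a x c r None \<Longrightarrow> A43 J a x c K r None"
| too_much_cache:
    "\<lbrakk> A43_place J a x c r (Some S); cache_used c (max_demand J x S) > 3 * K \<rbrakk>
     \<Longrightarrow> A43 J a x c K r None"
| success:
    "\<lbrakk> A43_place J a x c r (Some S); cache_used c (max_demand J x S) \<le> 3 * K \<rbrakk>
     \<Longrightarrow> A43 J a x c K r (Some (S, max_demand J x S))"

end

theory Submission
  imports Defs
begin

text \<open>A core of the given solution holds at most two large jobs, so the large jobs have total
  demand at most \<open>2 * K\<close>, however they are paired. The small jobs cost at most \<open>K\<close> more: a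
  dominant matching concentrates the large loads on as few cores as possible, so its least loaded
  cores have as much room for the most demanding small jobs as the solution can offer them.\<close>


section \<open>Dominance of matchings\<close>

text \<open>Dominance speaks about the heaviest edges, while small jobs are placed on the lightest
  cores. The two views are linked by the fact that all perfect matchings have the same total weight:
  a larger excess above every level \<open>t\<close> then means more room below every level
  \<open>t\<close>. Existence of a dominant matching is a genuine obstacle. In a general graph two
  perfect matchings can be incomparable: heaviest-first edge weights 6, 3, 3 and 5, 5, 2 can occur
  as the two perfect matchings of a 6-cycle. Here adjacency depends only on the sum of two weights,
  and this permits a greedy exchange. The constant 1/3 is used from both sides: three large jobs
  exceed load 1, and a small job lifts a core of load at most 1 to at most 4/3.\<close>

text \<open>For families of the same size, having the larger sum of the \<open>k\<close> largest values for every \<open>k\<close>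
  is the same as having the larger excess over every threshold. The excess is additive in the
  family, which makes it suitable for exchange arguments.\<close>

definition excess :: "('e \<Rightarrow> real) \<Rightarrow> 'e set \<Rightarrow> real \<Rightarrow> real" where
  "excess f A t = (\<Sum>e\<in>A. max 0 (f e - t))"

text \<open>Weak half of a duality: for \<open>k\<close> at least 1, the sum of the \<open>k\<close>
  largest values is the minimum over \<open>t\<close> of \<open>k * t + excess f A t\<close>. Any
  \<open>t\<close> gives an upper bound, since negative differences are truncated and further terms
  only add.\<close>

lemma sum_le_excess:
  fixes t :: real
  assumes "finite A" "G \<subseteq> A"
  shows "sum f G \<le> card G * t + excess f A t"
proof -
  have "sum f G = card G * t + (\<Sum>e\<in>G. f e - t)"
    by (simp add: sum_subtractf)
  also have "(\<Sum>e\<in>G. f e - t) \<le> (\<Sum>e\<in>G. max 0 (f e - t))"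
    by (rule sum_mono) simp
  also have "\<dots> \<le> excess f A t"
    unfolding excess_def using assms by (intro sum_mono2) auto
  finally show ?thesis by simp
qed

text \<open>The tight half: the bound is attained at the smallest value in the top set
  \<open>F\<close>, where nothing inside \<open>F\<close> is truncated and nothing outside
  contributes.\<close>

lemma sum_top_eq_excess:
  assumes "finite A" "F \<subseteq> A" "F \<noteq> {}" "\<And>e g. e \<in> F \<Longrightarrow> g \<in> A - F \<Longrightarrow> f g \<le> f e"
  obtains t :: real where "sum f F = card F * t + excess f A t"
proof -
  define t where "t = Min (f ` F)"
  have fin: "finite F" using assms finite_subset by blast
  then have "t \<in> f ` F" using assms(3) unfolding t_def by (intro Min_in) auto
  then obtain e0 where e0: "e0 \<in> F" "t = f e0" by auto
  have ge: "t \<le> f e" if "e \<in> F" for e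
    using fin that unfolding t_def by auto
  have le: "f g \<le> t" if "g \<in> A - F" for g
    using assms(4) e0 that by auto
  have "excess f A t = (\<Sum>e\<in>F. max 0 (f e - t))"
    unfolding excess_def using assms(1,2) le by (intro sum.mono_neutral_right) auto
  also have "\<dots> = (\<Sum>e\<in>F. f e - t)"
    using ge by (intro sum.cong) auto
  finally have "sum f F = card F * t + excess f A t"
    by (simp add: sum_subtractf)
  then show ?thesis using that by blast
qed

text \<open>Removes the description operator and the tie-breaking from dominance, leaving a set of
  \<open>k\<close> top edges. \<open>heavier\<close> is a strict total order on \<open>A\<close>, so
  counting predecessors is a bijection onto the numbers below \<open>card A\<close>, and
  \<open>F\<close> is the preimage of the numbers below \<open>k\<close>.\<close>

lemma sum_nth_heaviest:
  assumes lin: "linear_order_on E r" and "A \<subseteq> E" and fin: "finite A" and k: "k \<le> card A"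
  obtains F where "F \<subseteq> A" "card F = k"
    "(\<Sum>i=1..k. edge_weight w (nth_heaviest w r A i)) = sum (edge_weight w) F"
    "\<And>e g. e \<in> F \<Longrightarrow> g \<in> A - F \<Longrightarrow> edge_weight w g \<le> edge_weight w e"
proof -
  define rk where "rk e = card {f \<in> A. heavier w r f e}" for e
  have r: "trans r" "antisym r" "total_on E r"
    using lin unfolding linear_order_on_def partial_order_on_def preorder_on_def by auto
  have htrans: "heavier w r e g" if "heavier w r e f" "heavier w r f g" for e f g
  proof -
    have "(e, g) \<in> r" if "(e, f) \<in> r" "(f, g) \<in> r"
      using transD[OF r(1)] that by blast
    moreover have "e \<noteq> g" if "(e, f) \<in> r" "(f, g) \<in> r" "e \<noteq> f"
      using antisymD[OF r(2)] that by blast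
    ultimately show ?thesis using that unfolding heavier_def by auto
  qed
  have less: "rk e < rk f" if "e \<in> A" "heavier w r e f" for e f
    unfolding rk_def
  proof (rule psubset_card_mono)
    have "\<not> heavier w r e e" unfolding heavier_def by simp
    then show "{f \<in> A. heavier w r f e} \<subset> {g \<in> A. heavier w r g f}"
      using that htrans by blast
  qed (use fin in simp)
  have "heavier w r e f \<or> heavier w r f e" if "e \<in> A" "f \<in> A" "e \<noteq> f" for e f
  proof -
    have "e \<in> E" "f \<in> E" using that \<open>A \<subseteq> E\<close> by auto
    then have "(e, f) \<in> r \<or> (f, e) \<in> r" using that r(3) unfolding total_on_def by simp
    then show ?thesis using that(3) unfolding heavier_def by auto
  qed
  then have inj: "inj_on rk A"
    using less unfolding inj_on_def by (metis less_irrefl)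
  have "rk e < card A" if "e \<in> A" for e
    unfolding rk_def using that fin
    by (intro psubset_card_mono) (auto simp: heavier_def)
  \<comment> \<open>An injection into a set of the same finite size is onto, so every rank is
    taken.\<close>
  then have img: "rk ` A = {..<card A}"
    using inj by (intro card_subset_eq) (auto simp: card_image)
  define F where "F = {e \<in> A. rk e < k}"
  have nth: "nth_heaviest w r A (Suc (rk e)) = e" if "e \<in> A" for e
    unfolding nth_heaviest_def using that inj
    by (intro the_equality) (auto simp: rk_def[symmetric] inj_on_def)
  have F: "F \<subseteq> A" unfolding F_def by auto
  have imgF: "rk ` F = {..<k}"
  proof -
    have "rk ` F = rk ` A \<inter> {..<k}" unfolding F_def by auto
    then show ?thesis using img k by auto
  qed
  have injF: "inj_on rk F" using inj F inj_on_subset by blast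
  have "card F = k"
    using card_image[OF injF] imgF by simp
  moreover have "(\<Sum>i=1..k. edge_weight w (nth_heaviest w r A i)) = sum (edge_weight w) F"
  proof -
    have "(\<Sum>i=1..k. edge_weight w (nth_heaviest w r A i))
        = (\<Sum>i\<in>rk ` F. edge_weight w (nth_heaviest w r A (Suc i)))"
      unfolding imgF by (simp add: sum.atLeast1_atMost_eq)
    also have "\<dots> = sum (edge_weight w) F"
      using F nth by (subst sum.reindex[OF injF]) (auto intro!: sum.cong)
    finally show ?thesis .
  qed
  moreover have "edge_weight w g \<le> edge_weight w e" if "e \<in> F" "g \<in> A - F" for e g
    using that less[of g e] unfolding F_def heavier_def by force
  ultimately show ?thesis using that F by blast
qed

lemma dominates_iff_excess:
  assumes lin: "linear_order_on E r" and "A \<subseteq> E" "B \<subseteq> E" "finite A" "finite B"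
    and card: "card A = card B"
  shows "dominates w r A B \<longleftrightarrow> (\<forall>t. excess (edge_weight w) B t \<le> excess (edge_weight w) A t)"
proof (intro iffI allI)
  fix t
  assume dom: "dominates w r A B"
  \<comment> \<open>These are exactly the edges that contribute to the excess, so for
    \<open>G\<close> the weak duality at \<open>t\<close> is an equality.\<close>
  define G where "G = {e \<in> B. edge_weight w e > t}"
  have G: "G \<subseteq> B" unfolding G_def by auto
  then have k: "card G \<le> card B" using card_mono assms by blast
  have ex: "excess (edge_weight w) B t = sum (edge_weight w) G - card G * t"
  proof -
    have "excess (edge_weight w) B t = (\<Sum>e\<in>G. max 0 (edge_weight w e - t))"
      unfolding excess_def using assms by (intro sum.mono_neutral_right) (auto simp: G_def)
    also have "\<dots> = (\<Sum>e\<in>G. edge_weight w e - t)"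
      by (intro sum.cong) (auto simp: G_def)
    finally show ?thesis by (simp add: sum_subtractf)
  qed
  show "excess (edge_weight w) B t \<le> excess (edge_weight w) A t"
  \<comment> \<open>Dominance gives no inequality for an empty prefix, but then the excess of
    \<open>B\<close> is 0.\<close>
  proof (cases "card G = 0")
    case True
    then have "G = {}" using G assms finite_subset by fastforce
    then show ?thesis unfolding ex by (simp add: excess_def sum_nonneg)
  next
    case False
    obtain FB where FB: "FB \<subseteq> B" "card FB = card G"
      "(\<Sum>i=1..card G. edge_weight w (nth_heaviest w r B i)) = sum (edge_weight w) FB"
      "\<And>e g. e \<in> FB \<Longrightarrow> g \<in> B - FB \<Longrightarrow> edge_weight w g \<le> edge_weight w e"
      using sum_nth_heaviest[OF lin \<open>B \<subseteq> E\<close> \<open>finite B\<close> k] by blast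
    obtain FA where FA: "FA \<subseteq> A" "card FA = card G"
      "(\<Sum>i=1..card G. edge_weight w (nth_heaviest w r A i)) = sum (edge_weight w) FA"
      using sum_nth_heaviest[OF lin \<open>A \<subseteq> E\<close> \<open>finite A\<close>] k card by metis
    have "FB \<noteq> {}" using FB False by auto
    \<comment> \<open>A threshold tight for \<open>FB\<close> shows that no set of the same size, in
      particular \<open>G\<close>, has a larger sum.\<close>
    then obtain s :: real where s: "sum (edge_weight w) FB = card FB * s + excess (edge_weight w) B s"
      using sum_top_eq_excess FB assms by metis
    have "sum (edge_weight w) G \<le> sum (edge_weight w) FB"
      using sum_le_excess[OF \<open>finite B\<close> G, of "edge_weight w" s] s FB by simp
    also have "\<dots> \<le> sum (edge_weight w) FA"
      using dom False k card unfolding dominates_def FA(3)[symmetric] FB(3)[symmetric] by auto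
    also have "\<dots> \<le> card G * t + excess (edge_weight w) A t"
      using sum_le_excess[OF \<open>finite A\<close> FA(1)] FA(2) by metis
    finally show ?thesis using ex by simp
  qed
next
  assume ex: "\<forall>t. excess (edge_weight w) B t \<le> excess (edge_weight w) A t"
  show "dominates w r A B" unfolding dominates_def
  proof
    fix k assume k: "k \<in> {1..card A}"
    obtain FB where FB: "FB \<subseteq> B" "card FB = k"
      "(\<Sum>i=1..k. edge_weight w (nth_heaviest w r B i)) = sum (edge_weight w) FB"
      using sum_nth_heaviest[OF lin \<open>B \<subseteq> E\<close> \<open>finite B\<close>] k card by (metis atLeastAtMost_iff)
    obtain FA where FA: "FA \<subseteq> A" "card FA = k"
      "(\<Sum>i=1..k. edge_weight w (nth_heaviest w r A i)) = sum (edge_weight w) FA"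
      "\<And>e g. e \<in> FA \<Longrightarrow> g \<in> A - FA \<Longrightarrow> edge_weight w g \<le> edge_weight w e"
      using sum_nth_heaviest[OF lin \<open>A \<subseteq> E\<close> \<open>finite A\<close>] k by (metis atLeastAtMost_iff)
    have "FA \<noteq> {}" using FA k by auto
    \<comment> \<open>The threshold is chosen tight for \<open>A\<close>; for \<open>B\<close> the
      weak bound at the same \<open>t\<close> suffices.\<close>
    then obtain t :: real where t: "sum (edge_weight w) FA = card FA * t + excess (edge_weight w) A t"
      using sum_top_eq_excess FA assms by metis
    have "sum (edge_weight w) FB \<le> k * t + excess (edge_weight w) B t"
      using sum_le_excess[OF \<open>finite B\<close> FB(1)] FB(2) by metis
    then show "(\<Sum>i=1..k. edge_weight w (nth_heaviest w r B i))
        \<le> (\<Sum>i=1..k. edge_weight w (nth_heaviest w r A i))"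
      unfolding FA(3) FB(3) t using ex[rule_format, of t] FA(2) by simp
  qed
qed


section \<open>Perfect matchings in threshold graphs\<close>

text \<open>The edges of a threshold graph. The vertex set is arbitrary because the induction below
  deletes two vertices at a time, which leads out of the graphs \<open>G_edges\<close>.\<close>

definition threshold_edges :: "('v \<Rightarrow> real) \<Rightarrow> 'v set \<Rightarrow> 'v set set" where
  "threshold_edges w V = {{u, v} | u v. u \<in> V \<and> v \<in> V \<and> u \<noteq> v \<and> w u + w v \<le> 1}"

lemma threshold_edgesE:
  assumes "e \<in> threshold_edges w V" "u \<in> e"
  obtains v where "e = {u, v}" "u \<in> V" "v \<in> V" "u \<noteq> v" "w u + w v \<le> 1"
proof -
  obtain p q where e: "e = {p, q}" "p \<in> V" "q \<in> V" "p \<noteq> q" "w p + w q \<le> 1"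
    using assms(1) unfolding threshold_edges_def by blast
  then consider "u = p" | "u = q" using assms(2) by blast
  then show ?thesis
  proof cases
    case 1
    then show ?thesis using that[of q] e by simp
  next
    case 2
    then show ?thesis using that[of p] e by (simp add: insert_commute add.commute)
  qed
qed

lemma perfect_matching_unique:
  assumes "perfect_matching V (threshold_edges w V) M" "e \<in> M" "f \<in> M" "v \<in> e" "v \<in> f"
  shows "e = f"
proof -
  have "v \<in> V" using assms unfolding perfect_matching_def by (meson subsetD threshold_edgesE)
  then show ?thesis using assms unfolding perfect_matching_def by blast
qed

lemma perfect_matching_partner:
  assumes "perfect_matching V (threshold_edges w V) M" "u \<in> V"
  obtains v where "{u, v} \<in> M" "v \<in> V" "u \<noteq> v" "w u + w v \<le> 1"
proof -
  obtain e where e: "e \<in> M" "u \<in> e" using assms unfolding perfect_matching_def by blast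
  then have "e \<in> threshold_edges w V" using assms unfolding perfect_matching_def by blast
  then show ?thesis using threshold_edgesE e that by metis
qed

lemma perfect_matching_finite:
  assumes "perfect_matching V (threshold_edges w V) M" "finite V"
  shows "finite M"
proof -
  have "M \<subseteq> Pow V"
    using assms(1) unfolding perfect_matching_def threshold_edges_def by blast
  then show ?thesis using assms(2) finite_subset by blast
qed

text \<open>The edges partition \<open>V\<close>. With \<open>w\<close> for \<open>g\<close> this
  shows that all perfect matchings have equal total weight, with the constant 1 that they have equal
  size.\<close>

lemma sum_perfect_matching:
  assumes "perfect_matching V (threshold_edges w V) M" "finite V"
  shows "(\<Sum>e\<in>M. \<Sum>v\<in>e. g v) = (\<Sum>v\<in>V. g v)"
proof -
  have sub: "e \<subseteq> V" if "e \<in> M" for e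
    using that assms(1) unfolding perfect_matching_def by (meson subsetD subsetI threshold_edgesE)
  moreover have "\<exists>e\<in>M. v \<in> e" if "v \<in> V" for v
    using that assms(1) unfolding perfect_matching_def by blast
  ultimately have U: "\<Union>M = V" by blast
  have fin: "\<forall>e\<in>M. finite e"
    using sub finite_subset[OF _ assms(2)] by simp
  have "e \<inter> f = {}" if "e \<in> M" "f \<in> M" "e \<noteq> f" for e f
    using perfect_matching_unique[OF assms(1) that(1,2)] that(3) by blast
  then have "sum g (\<Union>M) = (\<Sum>e\<in>M. sum g e)"
    using sum.Union_disjoint[OF fin] by (simp add: comp_def)
  then show ?thesis using U by simp
qed

lemma card_perfect_matching:
  assumes "perfect_matching V (threshold_edges w V) M" "finite V"
  shows "card V = 2 * card M"
proof -
  have "card e = 2" if "e \<in> M" for e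
  proof -
    have "e \<in> threshold_edges w V"
      using that assms(1) unfolding perfect_matching_def by blast
    then show ?thesis unfolding threshold_edges_def by auto
  qed
  then show ?thesis
    using sum_perfect_matching[OF assms, of "\<lambda>_. 1::nat"] by simp
qed

lemma perfect_matching_remove:
  assumes pm: "perfect_matching V (threshold_edges w V) M" and "{u, v} \<in> M"
  shows "perfect_matching (V - {u, v}) (threshold_edges w (V - {u, v})) (M - {{u, v}})"
  unfolding perfect_matching_def
proof (intro conjI ballI subsetI)
  fix e assume e: "e \<in> M - {{u, v}}"
  have disj: "z \<notin> {u, v}" if "z \<in> e" for z
    using perfect_matching_unique[OF pm _ assms(2) that] e by blast
  have "e \<in> threshold_edges w V" using e pm unfolding perfect_matching_def by blast
  then show "e \<in> threshold_edges w (V - {u, v})"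
    using disj unfolding threshold_edges_def by blast
next
  fix z assume "z \<in> V - {u, v}"
  then show "\<exists>!e. e \<in> M - {{u, v}} \<and> z \<in> e"
    using pm unfolding perfect_matching_def by (metis DiffD1 DiffD2 DiffI singletonD)
qed

lemma perfect_matching_insert:
  assumes pm: "perfect_matching (V - {u, v}) (threshold_edges w (V - {u, v})) M"
    and uv: "u \<in> V" "v \<in> V" "u \<noteq> v" "w u + w v \<le> 1"
  shows "perfect_matching V (threshold_edges w V) (insert {u, v} M)" and "{u, v} \<notin> M"
proof -
  have sub: "M \<subseteq> threshold_edges w (V - {u, v})"
    and ex1: "\<forall>z\<in>V - {u, v}. \<exists>!e. e \<in> M \<and> z \<in> e"
    using pm unfolding perfect_matching_def by auto
  have disj: "z \<notin> {u, v}" if "e \<in> M" "z \<in> e" for e z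
    using threshold_edgesE[OF subsetD[OF sub that(1)] that(2)] by blast
  then show "{u, v} \<notin> M" by blast
  have "threshold_edges w (V - {u, v}) \<subseteq> threshold_edges w V"
    unfolding threshold_edges_def by blast
  moreover have "{u, v} \<in> threshold_edges w V"
    using uv unfolding threshold_edges_def by blast
  moreover have "\<exists>!e. e \<in> insert {u, v} M \<and> z \<in> e" if z: "z \<in> V" for z
  proof (cases "z \<in> {u, v}")
    case True
    then show ?thesis using disj[of _ z] by (intro ex1I[of _ "{u, v}"]) auto
  next
    case False
    then have "\<exists>!e. e \<in> M \<and> z \<in> e" using ex1 z by simp
    moreover have "e \<in> insert {u, v} M \<and> z \<in> e \<longleftrightarrow> e \<in> M \<and> z \<in> e" for e
      using False by auto
    ultimately show ?thesis by simp
  qed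
  ultimately show "perfect_matching V (threshold_edges w V) (insert {u, v} M)"
    using sub unfolding perfect_matching_def by (meson insert_subset subset_trans)
qed

lemma excess_insert:
  assumes "finite A" "e \<notin> A"
  shows "excess f (insert e A) t = max 0 (f e - t) + excess f A t"
  using assms unfolding excess_def by simp

text \<open>Matching a heaviest vertex \<open>u\<close> with its heaviest neighbour \<open>v\<close> and the former partners of
  \<open>u\<close> and \<open>v\<close> with each other makes one edge at least as heavy as both old edges and keeps the
  sum, so no excess decreases.\<close>

lemma perfect_matching_exchange:
  assumes pm: "perfect_matching V (threshold_edges w V) B" and fin: "finite V"
    and u: "u \<in> V" "\<forall>z\<in>V. w z \<le> w u"
    and v: "v \<in> V" "u \<noteq> v" "w u + w v \<le> 1"
      "\<forall>z\<in>V. z \<noteq> u \<longrightarrow> w u + w z \<le> 1 \<longrightarrow> w z \<le> w v"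
  obtains B' where "perfect_matching V (threshold_edges w V) B'" "{u, v} \<in> B'"
    "\<And>t. excess (edge_weight w) B t \<le> excess (edge_weight w) B' t"
proof (cases "{u, v} \<in> B")
  case True
  then show ?thesis using that pm by blast
next
  case False
  obtain v' where v': "{u, v'} \<in> B" "v' \<in> V" "u \<noteq> v'" "w u + w v' \<le> 1"
    using perfect_matching_partner[OF pm u(1)] by blast
  obtain z where z: "{v, z} \<in> B" "z \<in> V" "v \<noteq> z" "w v + w z \<le> 1"
    using perfect_matching_partner[OF pm v(1)] by blast
  have neq: "v \<noteq> v'" using False v' by blast
  have ne: "{v, z} \<noteq> {u, v'}" using False v' v by (metis doubleton_eq_iff)
  have zn: "z \<noteq> u" "z \<noteq> v'"
    using perfect_matching_unique[OF pm v'(1) z(1)] ne by blast+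
  define V1 where "V1 = V - {u, v'}"
  define V2 where "V2 = V1 - {v, z}"
  define B2 where "B2 = B - {{u, v'}} - {{v, z}}"
  have pm1: "perfect_matching V1 (threshold_edges w V1) (B - {{u, v'}})"
    unfolding V1_def by (rule perfect_matching_remove[OF pm v'(1)])
  have pm2: "perfect_matching V2 (threshold_edges w V2) B2"
    unfolding V2_def B2_def
    by (rule perfect_matching_remove[OF pm1]) (use z ne in blast)
  have finB2: "finite B2"
    using perfect_matching_finite[OF pm fin] unfolding B2_def by blast
  have B: "B = insert {u, v'} (insert {v, z} B2)" "{u, v'} \<notin> insert {v, z} B2" "{v, z} \<notin> B2"
    using v' z ne unfolding B2_def by blast+
  have V2: "V2 = V - {u, v} - {v', z}"
    unfolding V2_def V1_def by blast
  \<comment> \<open>As \<open>v'\<close> is also a neighbour of \<open>u\<close>, the choice of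
    \<open>v\<close> applies to it. Hence \<open>{v', z}\<close> is an edge, being no heavier than
    \<open>{v, z}\<close>, and \<open>{u, v}\<close> is at least as heavy as
    \<open>{u, v'}\<close>.\<close>
  have vv: "w v' \<le> w v" using v(4) v' by simp
  have n1: "perfect_matching (V - {u, v}) (threshold_edges w (V - {u, v})) (insert {v', z} B2)"
    and n2: "{v', z} \<notin> B2"
    using perfect_matching_insert[OF pm2[unfolded V2]] v' z zn neq vv by auto
  have m1: "perfect_matching V (threshold_edges w V) (insert {u, v} (insert {v', z} B2))"
    and m2: "{u, v} \<notin> insert {v', z} B2"
    using perfect_matching_insert[OF n1] u v by auto
  have "excess (edge_weight w) B t
      \<le> excess (edge_weight w) (insert {u, v} (insert {v', z} B2)) t" for t
  proof -
    have "edge_weight w {u, v'} = w u + w v'" "edge_weight w {v, z} = w v + w z"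
      "edge_weight w {u, v} = w u + w v" "edge_weight w {v', z} = w v' + w z"
      using v' z v zn by (auto simp: edge_weight_def)
    moreover have "w z \<le> w u" using u z by blast
    ultimately show ?thesis
      using vv finB2 B(2,3) n2 m2 unfolding B(1) by (simp add: excess_insert)
  qed
  then show ?thesis using that[OF m1] by blast
qed

text \<open>Greedy induction: by the exchange every matching can be replaced by one that contains
  \<open>{u, v}\<close> without lowering any excess, and the excess of the rest is bounded by the
  induction hypothesis for \<open>V - {u, v}\<close>.\<close>

lemma ex_max_excess_matching:
  assumes "finite V" "\<exists>M. perfect_matching V (threshold_edges w V) M"
  shows "\<exists>Q. perfect_matching V (threshold_edges w V) Q \<and>
    (\<forall>B t. perfect_matching V (threshold_edges w V) B \<longrightarrow>
       excess (edge_weight w) B t \<le> excess (edge_weight w) Q t)"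
  using assms
proof (induction "card V" arbitrary: V rule: less_induct)
  case less
  show ?case
  proof (cases "V = {}")
    case True
    then have "B = {}" if "perfect_matching V (threshold_edges w V) B" for B
      using that unfolding perfect_matching_def threshold_edges_def by blast
    then show ?thesis using less.prems by blast
  next
    case False
    obtain u where u: "u \<in> V" "\<forall>z\<in>V. w z \<le> w u"
      using ex_is_arg_min_if_finite[OF less.prems(1) False, of "\<lambda>z. - w z"]
      by (auto simp: is_arg_min_linorder)
    obtain M where M: "perfect_matching V (threshold_edges w V) M" using less.prems by blast
    define N where "N = {z \<in> V. z \<noteq> u \<and> w u + w z \<le> 1}"
    have "finite N" using less.prems unfolding N_def by simp
    moreover have "N \<noteq> {}"
      using perfect_matching_partner[OF M u(1)] unfolding N_def by blast
    ultimately obtain v where "v \<in> N" "\<forall>z\<in>N. w z \<le> w v"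
      using ex_is_arg_min_if_finite[of N "\<lambda>z. - w z"]
      by (auto simp: is_arg_min_linorder)
    then have v: "v \<in> V" "u \<noteq> v" "w u + w v \<le> 1"
      "\<forall>z\<in>V. z \<noteq> u \<longrightarrow> w u + w z \<le> 1 \<longrightarrow> w z \<le> w v"
      unfolding N_def by blast+
    let ?V = "V - {u, v}"
    have exch: "\<exists>B'. perfect_matching V (threshold_edges w V) B' \<and> {u, v} \<in> B' \<and>
        (\<forall>t. excess (edge_weight w) B t \<le> excess (edge_weight w) B' t)"
      if B: "perfect_matching V (threshold_edges w V) B" for B
    proof -
      obtain B' where "perfect_matching V (threshold_edges w V) B'" "{u, v} \<in> B'"
        "\<And>t. excess (edge_weight w) B t \<le> excess (edge_weight w) B' t"
        using perfect_matching_exchange[OF B less.prems(1) u v] by metis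
      then show ?thesis by blast
    qed
    obtain M' where "perfect_matching V (threshold_edges w V) M'" "{u, v} \<in> M'"
      using exch[OF M] by blast
    then have ex: "\<exists>M. perfect_matching ?V (threshold_edges w ?V) M"
      using perfect_matching_remove[of V w M' u v] by blast
    have smaller: "card ?V < card V"
      using less.prems(1) u(1) by (intro psubset_card_mono) auto
    obtain Q where Q: "perfect_matching ?V (threshold_edges w ?V) Q"
      "\<And>B t. perfect_matching ?V (threshold_edges w ?V) B \<Longrightarrow>
       excess (edge_weight w) B t \<le> excess (edge_weight w) Q t"
      using less.hyps[OF smaller finite_Diff[OF less.prems(1)] ex] by blast
    have finQ: "finite Q" using perfect_matching_finite[OF Q(1)] less.prems(1) by blast
    have ins: "perfect_matching V (threshold_edges w V) (insert {u, v} Q)" "{u, v} \<notin> Q"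
      using perfect_matching_insert[OF Q(1)] u v by auto
    have "excess (edge_weight w) B t \<le> excess (edge_weight w) (insert {u, v} Q) t"
      if B: "perfect_matching V (threshold_edges w V) B" for B t
    proof -
      obtain B' where B': "perfect_matching V (threshold_edges w V) B'" "{u, v} \<in> B'"
        "\<And>t. excess (edge_weight w) B t \<le> excess (edge_weight w) B' t"
        using exch[OF B] by blast
      have "finite B'" using perfect_matching_finite[OF B'(1)] less.prems(1) by blast
      then have "excess (edge_weight w) B' t
          = max 0 (edge_weight w {u, v} - t) + excess (edge_weight w) (B' - {{u, v}}) t"
        using excess_insert[of "B' - {{u, v}}" "{u, v}"] B'(2) by (simp add: insert_absorb)
      also have "\<dots> \<le> excess (edge_weight w) (insert {u, v} Q) t"
        using Q(2)[OF perfect_matching_remove[OF B'(1,2)]] finQ ins(2)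
        by (simp add: excess_insert)
      finally show ?thesis using B'(3)[of t] by linarith
    qed
    then show ?thesis using ins(1) by blast
  qed
qed

lemma dominant_perfect_matching_iff_excess:
  assumes "finite V" "linear_order_on (threshold_edges w V) r"
  shows "dominant_perfect_matching V (threshold_edges w V) w r Q \<longleftrightarrow>
    perfect_matching V (threshold_edges w V) Q \<and>
    (\<forall>B t. perfect_matching V (threshold_edges w V) B \<longrightarrow>
       excess (edge_weight w) B t \<le> excess (edge_weight w) Q t)"
proof -
  have "dominates w r Q B \<longleftrightarrow> (\<forall>t. excess (edge_weight w) B t \<le> excess (edge_weight w) Q t)"
    if "perfect_matching V (threshold_edges w V) Q" "perfect_matching V (threshold_edges w V) B"
    for B
  proof (rule dominates_iff_excess[OF assms(2)])
    show "Q \<subseteq> threshold_edges w V" "B \<subseteq> threshold_edges w V"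
      using that unfolding perfect_matching_def by auto
    show "finite Q" "finite B" using that perfect_matching_finite assms(1) by blast+
    show "card Q = card B" using that[THEN card_perfect_matching, OF assms(1)] by simp
  qed
  then show ?thesis unfolding dominant_perfect_matching_def by blast
qed


section \<open>Placing the small jobs\<close>

lemma place_small_cores:
  assumes "place_small a ld cs js S = Some S'" "distinct js"
  shows "(j \<notin> set js \<longrightarrow> S' j = S j) \<and> (j \<in> set js \<longrightarrow> S' j \<in> set cs)"
  using assms
proof (induction a ld cs js S rule: place_small.induct)
  case (3 a ld i cs j' js S)
  show ?case
  proof (cases "ld i > 1")
    case True
    then show ?thesis using 3 by auto
  next
    case False
    have "place_small a (ld(i := ld i + a j')) (i # cs) js (S(j' := i)) = Some S'"
      using 3(3) False by simp
    from 3(2)[OF False this] show ?thesis using 3(4) by auto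
  qed
qed auto

text \<open>A job is added only while the load is at most 1, and it adds at most 1/3. The
  \<open>max\<close> accounts for cores that are already above 4/3, which receive nothing
  more.\<close>

lemma place_small_load:
  assumes "place_small a ld cs js S = Some S'" "distinct js" "\<forall>j\<in>set js. a j \<le> 1/3"
  shows "ld i + (\<Sum>j | j \<in> set js \<and> S' j = i. a j) \<le> max (ld i) (4/3)"
  using assms
proof (induction a ld cs js S rule: place_small.induct)
  case (3 a ld i' cs j js S)
  show ?case
  proof (cases "ld i' > 1")
    case True
    then show ?thesis using 3 by auto
  next
    case False
    have pl: "place_small a (ld(i' := ld i' + a j)) (i' # cs) js (S(j := i')) = Some S'"
      using 3 False by simp
    have IH: "(ld(i' := ld i' + a j)) i + (\<Sum>j | j \<in> set js \<and> S' j = i. a j)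
        \<le> max ((ld(i' := ld i' + a j)) i) (4/3)"
      using 3(2)[OF False pl] 3(4,5) by simp
    have S'j: "S' j = i'" using place_small_cores[OF pl, of j] 3 by simp
    show ?thesis
    proof (cases "i = i'")
      case True
      then have "{k \<in> set (j # js). S' k = i} = insert j {k \<in> set js. S' k = i}"
        using S'j by auto
      then show ?thesis using IH True False 3 by auto
    next
      case i: False
      then have "{k \<in> set (j # js). S' k = i} = {k \<in> set js. S' k = i}"
        using S'j by auto
      then show ?thesis using IH i by (simp add: Collect_conj_eq)
    qed
  qed
qed auto

text \<open>On failure every core has been left with load above 1. Moving a job from the list to a
  core keeps the sum on the right, and the job that finds no core makes the inequality strict even
  for an empty list of cores.\<close>

lemma place_small_None:
  assumes "place_small a ld cs js S = None" "distinct cs" "\<forall>j\<in>set js. a j > 0"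
  shows "real (length cs) < sum_list (map ld cs) + sum_list (map a js)"
  using assms
proof (induction a ld cs js S rule: place_small.induct)
  case (2 a ld j js S)
  have "0 \<le> sum_list (map a js)" using 2 by (intro sum_list_nonneg) (auto intro: less_imp_le)
  then show ?case using 2 by simp
next
  case (3 a ld i cs j js S)
  have "map (ld(i := v)) cs = map ld cs" for v using 3 by auto
  then show ?case using 3 by (cases "ld i > 1") (auto simp del: fun_upd_apply simp: fun_upd_same)
qed auto

text \<open>The \<open>k\<close> cores before that of \<open>j\<close> were filled above 1 by jobs
  preceding \<open>j\<close>, which demand at least \<open>x j\<close>. Their initial free room is
  therefore less than the load of those jobs; \<open>j\<close> itself gives strictness when
  \<open>k\<close> is 0.\<close>

lemma place_small_prefix_load:
  fixes x :: "'j \<Rightarrow> real"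
  assumes "place_small a ld cs js S = Some S'" "distinct cs" "distinct js"
    "\<forall>j\<in>set js. a j > 0" "sorted_wrt (\<lambda>j k. x j \<ge> x k) js"
    "j \<in> set js" "k < length cs" "S' j = cs ! k"
  shows "(\<Sum>i\<leftarrow>take k cs. 1 - ld i) < (\<Sum>y\<leftarrow>filter (\<lambda>y. x j \<le> x y) js. a y)"
  using assms
proof (induction a ld cs js S arbitrary: k rule: place_small.induct)
  case (3 a ld i cs j' js S)
  show ?case
  proof (cases "ld i > 1")
    case True
    have pl: "place_small a ld cs (j' # js) S = Some S'" using 3 True by simp
    have "S' j \<in> set cs" using place_small_cores[OF pl] 3 by blast
    then obtain k' where k: "k = Suc k'" using 3 by (cases k) auto
    have "(\<Sum>i\<leftarrow>take k' cs. 1 - ld i) < (\<Sum>y\<leftarrow>filter (\<lambda>y. x j \<le> x y) (j' # js). a y)"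
      using 3 True pl k by auto
    \<comment> \<open>The skipped core adds the negative term \<open>1 - ld i\<close> on the
      left.\<close>
    then show ?thesis using True k by simp
  next
    case False
    have pl: "place_small a (ld(i := ld i + a j')) (i # cs) js (S(j' := i)) = Some S'"
      using 3 False by simp
    show ?thesis
    proof (cases "j = j'")
      case True
      have "S' j = i" using place_small_cores[OF pl, of j] 3 True by simp
      then have k: "k = 0" using 3 by (cases k) auto
      have "0 \<le> (\<Sum>y\<leftarrow>filter (\<lambda>y. x j \<le> x y) js. a y)"
        using 3 by (intro sum_list_nonneg) (auto intro: less_imp_le)
      moreover have "a j' > 0" using 3 by simp
      ultimately show ?thesis using k by (simp add: True)
    next
      case j: False
      then have jin: "j \<in> set js" using 3 by simp
      have IH: "(\<Sum>l\<leftarrow>take k (i # cs). 1 - (ld(i := ld i + a j')) l)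
          < (\<Sum>y\<leftarrow>filter (\<lambda>y. x j \<le> x y) js. a y)"
        using 3(2)[OF False pl] 3(4-) jin by simp
      have "(\<Sum>l\<leftarrow>take m cs. 1 - (ld(i := ld i + a j')) l) = (\<Sum>l\<leftarrow>take m cs. 1 - ld l)" for m
        using 3(4) by (intro arg_cong[where f = sum_list] map_cong) (auto dest: in_set_takeD)
      moreover have "a j' > 0" using 3(6) by simp
      \<comment> \<open>Placing \<open>j'\<close> lowers the left side by at most
        \<open>a j'\<close> (by nothing if \<open>k\<close> is 0), while the right side loses
        exactly \<open>a j'\<close>, because \<open>j'\<close> precedes \<open>j\<close> and so
        passes the filter.\<close>
      ultimately have "(\<Sum>l\<leftarrow>take k (i # cs). 1 - ld l) - a j'
          \<le> (\<Sum>l\<leftarrow>take k (i # cs). 1 - (ld(i := ld i + a j')) l)"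
        by (cases k) (simp_all del: fun_upd_apply add: fun_upd_same)
      moreover have "x j \<le> x j'" using 3 jin by auto
      ultimately show ?thesis using IH by simp
    qed
  qed
qed auto

text \<open>Greedy choice of distinct representatives: when index \<open>k\<close> is served, only
  \<open>k\<close> elements of \<open>C\<close> are taken, and more than \<open>k\<close> are
  suitable.\<close>

lemma sum_le_of_many_above:
  fixes d :: "nat \<Rightarrow> real"
  assumes fin: "finite C" and p: "\<forall>i\<in>C. p i \<ge> 0"
    and many: "\<And>k. k < m \<Longrightarrow> k < card {i \<in> C. d k \<le> p i}"
  shows "(\<Sum>k<m. d k) \<le> (\<Sum>i\<in>C. p i)"
proof -
  have "\<exists>f. inj_on f {..<m} \<and> f ` {..<m} \<subseteq> C \<and> (\<forall>k<m. d k \<le> p (f k))"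
    using many
  proof (induction m)
    case (Suc m)
    then obtain f where f: "inj_on f {..<m}" "f ` {..<m} \<subseteq> C" "\<forall>k<m. d k \<le> p (f k)"
      by (meson less_Suc_eq)
    have "card (f ` {..<m}) < card {i \<in> C. d m \<le> p i}"
      using Suc.prems[of m] card_image[OF f(1)] by simp
    then have "\<not> {i \<in> C. d m \<le> p i} \<subseteq> f ` {..<m}"
      by (metis card_mono finite_imageI finite_lessThan not_less)
    then obtain i where i: "i \<in> C" "d m \<le> p i" "i \<notin> f ` {..<m}" by blast
    have img: "f(m := i) ` {..<m} = f ` {..<m}" by (intro image_cong) auto
    have "inj_on (f(m := i)) {..<Suc m}"
      unfolding lessThan_Suc using f(1) i(3) img
      by (auto simp: inj_on_def)
    moreover have "f(m := i) ` {..<Suc m} \<subseteq> C"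
      unfolding lessThan_Suc image_insert img using f(2) i(1) by simp
    moreover have "\<forall>k<Suc m. d k \<le> p ((f(m := i)) k)"
      using f(3) i(2) by (simp add: less_Suc_eq)
    ultimately show ?case by blast
  qed simp
  then obtain f where f: "inj_on f {..<m}" "f ` {..<m} \<subseteq> C" "\<forall>k<m. d k \<le> p (f k)" by blast
  have "(\<Sum>k<m. d k) \<le> (\<Sum>k<m. p (f k))" using f(3) by (intro sum_mono) auto
  also have "\<dots> = (\<Sum>i\<in>f ` {..<m}. p i)" using f(1) by (simp add: sum.reindex)
  also have "\<dots> \<le> (\<Sum>i\<in>C. p i)" using fin f(2) p by (intro sum_mono2) auto
  finally show ?thesis .
qed


section \<open>Loads and the matching of a solution\<close>

lemma sum_core_load:
  assumes "finite J" "\<forall>j\<in>J. S j < c"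
  shows "(\<Sum>i<c. core_load J a S i) = sum a J"
  unfolding core_load_def by (rule sum.group) (use assms in auto)

lemma large_jobs_subset: "large_jobs J a \<subseteq> J"
  unfolding large_jobs_def by blast

lemma core_load_split:
  assumes "finite J"
  shows "core_load J a S i = core_load (large_jobs J a) a S i + core_load (small_jobs J a) a S i"
proof -
  let ?L = "{j \<in> large_jobs J a. S j = i}" and ?M = "{j \<in> small_jobs J a. S j = i}"
  have "{j \<in> J. S j = i} = ?L \<union> ?M" "?L \<inter> ?M = {}" "finite ?L" "finite ?M"
    using assms by (auto simp: large_jobs_def small_jobs_def)
  then show ?thesis unfolding core_load_def by (simp add: sum.union_disjoint)
qed

lemma core_load_large_le:
  assumes "finite J" "\<forall>j\<in>J. a j > 0"
  shows "core_load (large_jobs J a) a S i \<le> core_load J a S i"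
  unfolding core_load_def using assms
  by (intro sum_mono2) (auto simp: large_jobs_def intro: less_imp_le)

text \<open>Three loads above 1/3 would exceed 1.\<close>

lemma card_large_le_2:
  assumes "finite J" "\<forall>j\<in>J. a j > 0" "core_load J a S i \<le> 1"
  shows "card {j \<in> large_jobs J a. S j = i} \<le> 2"
proof (rule ccontr)
  let ?L = "{j \<in> large_jobs J a. S j = i}"
  assume "\<not> card ?L \<le> 2"
  then have c: "card ?L \<ge> 3" by simp
  then have "?L \<noteq> {}" by (metis card.empty not_numeral_le_zero)
  moreover have "finite ?L" using finite_subset[OF large_jobs_subset assms(1)] by simp
  ultimately have "(\<Sum>j\<in>?L. 1/3) < (\<Sum>j\<in>?L. a j)"
    by (intro sum_strict_mono) (auto simp: large_jobs_def)
  also have "\<dots> \<le> 1"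
    using core_load_large_le[OF assms(1,2), of S i] assms(3) by (simp add: core_load_def)
  finally show False using c by simp
qed

lemma card_eq_sum_fibres:
  fixes S :: "'a \<Rightarrow> nat"
  assumes "finite A" "\<forall>j\<in>A. S j < c"
  shows "card A = (\<Sum>i<c. card {j \<in> A. S j = i})"
proof -
  have "S ` A \<subseteq> {..<c}" using assms(2) by auto
  then show ?thesis using sum.group[OF assms(1) finite_lessThan, of S c "\<lambda>_. 1::nat"] by simp
qed

lemma card_large_jobs_le:
  assumes "finite J" "\<forall>j\<in>J. a j > 0" "\<forall>j\<in>J. S j < c" "\<forall>i<c. core_load J a S i \<le> 1"
  shows "card (large_jobs J a) \<le> 2 * c"
proof -
  have fin: "finite (large_jobs J a)" using finite_subset[OF large_jobs_subset assms(1)] .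
  have S: "\<forall>j\<in>large_jobs J a. S j < c" using assms(3) by (auto simp: large_jobs_def)
  have "card (large_jobs J a) = (\<Sum>i<c. card {j \<in> large_jobs J a. S j = i})"
    by (rule card_eq_sum_fibres[OF fin S])
  also have "\<dots> \<le> (\<Sum>i<c. 2)"
    by (rule sum_mono) (use card_large_le_2[OF assms(1,2)] assms(4) in simp)
  finally show ?thesis by simp
qed

lemma G_edges_eq: "G_edges J a c = threshold_edges (vertex_weight a) (G_verts J a c)"
  unfolding G_edges_def threshold_edges_def ..

lemma finite_G_verts:
  assumes "finite J"
  shows "finite (G_verts J a c)"
  using finite_subset[OF large_jobs_subset assms] unfolding G_verts_def by simp

lemma card_G_verts:
  assumes "finite J" "card (large_jobs J a) \<le> 2 * c"
  shows "card (G_verts J a c) = 2 * c"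
proof -
  have "card (G_verts J a c) = card (Job ` large_jobs J a)
      + card (Artificial ` {..<2 * c - card (large_jobs J a)} :: 'a vertex set)"
    unfolding G_verts_def using finite_subset[OF large_jobs_subset assms(1)]
    by (intro card_Un_disjoint) auto
  then show ?thesis using assms(2) by (simp add: card_image inj_on_def)
qed

lemma Job_in_G_verts: "Job j \<in> G_verts J a c \<longleftrightarrow> j \<in> large_jobs J a"
  unfolding G_verts_def by auto

lemma edge_weight_jobs:
  assumes "finite J" "e \<subseteq> G_verts J a c"
  shows "edge_weight (vertex_weight a) e = (\<Sum>j | j \<in> large_jobs J a \<and> Job j \<in> e. a j)"
proof -
  let ?L = "{j \<in> large_jobs J a. Job j \<in> e}"
  have "finite e" using assms finite_G_verts finite_subset by metis
  then have "edge_weight (vertex_weight a) e = (\<Sum>v\<in>Job ` ?L. vertex_weight a v)"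
    unfolding edge_weight_def
    by (rule sum.mono_neutral_right) (use assms(2) in \<open>auto simp: G_verts_def\<close>)
  also have "\<dots> = (\<Sum>j\<in>?L. a j)"
    by (subst sum.reindex) (auto simp: inj_on_def)
  finally show ?thesis by simp
qed

text \<open>Each \<open>i\<close> offers \<open>n i\<close> slots, and \<open>B\<close> is put in
  bijection with all slots. This serves to distribute the artificial vertices over the
  cores.\<close>

lemma ex_fun_with_fibre_cards:
  assumes "finite I" "finite B" "card B = (\<Sum>i\<in>I. n i)"
  shows "\<exists>g. g ` B \<subseteq> I \<and> (\<forall>i\<in>I. card {b \<in> B. g b = i} = n i)"
proof -
  have "card B = card (SIGMA i:I. {..<n i})" using assms by simp
  then obtain h where h: "bij_betw h B (SIGMA i:I. {..<n i})"
    using finite_same_card_bij[OF assms(2) finite_SigmaI[OF assms(1) finite_lessThan]] by blast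
  then have img: "h ` B = (SIGMA i:I. {..<n i})" and inj: "inj_on h B"
    unfolding bij_betw_def by auto
  have "card {b \<in> B. fst (h b) = i} = n i" if "i \<in> I" for i
  proof -
    have "h ` {b \<in> B. fst (h b) = i} = h ` B \<inter> {z. fst z = i}" by auto
    also have "\<dots> = {i} \<times> {..<n i}" unfolding img using that by auto
    finally have himg: "h ` {b \<in> B. fst (h b) = i} = {i} \<times> {..<n i}" .
    have "inj_on h {b \<in> B. fst (h b) = i}"
      by (rule inj_on_subset[OF inj]) blast
    from card_image[OF this] have "card {b \<in> B. fst (h b) = i} = card ({i} \<times> {..<n i})"
      unfolding himg by (rule sym)
    then show ?thesis by (simp add: card_cartesian_product)
  qed
  moreover have "(fst \<circ> h) ` B \<subseteq> I" unfolding image_comp[symmetric] img by auto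
  ultimately show ?thesis by (intro exI[of _ "fst \<circ> h"]) simp
qed

text \<open>The edge of a core consists of its large jobs, padded to two vertices by artificial
  ones. The number of artificial vertices is exactly the total number of missing endpoints, and a
  large load of at most 1 makes the pair an edge.\<close>

lemma solution_matching:
  assumes fin: "finite J" and pos: "\<forall>j\<in>J. a j > 0"
    and S: "\<forall>j\<in>J. S j < c" and ld: "\<forall>i<c. core_load J a S i \<le> 1"
  obtains e where "inj_on e {..<c}"
    "perfect_matching (G_verts J a c) (G_edges J a c) (e ` {..<c})"
    "\<And>i. i < c \<Longrightarrow> edge_weight (vertex_weight a) (e i) = core_load (large_jobs J a) a S i"
proof -
  let ?L = "large_jobs J a" and ?V = "G_verts J a c"
  let ?B = "Artificial ` {..<2 * c - card ?L} :: 'a vertex set"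
  have finL: "finite ?L" using finite_subset[OF large_jobs_subset fin] .
  have SL: "\<forall>j\<in>?L. S j < c" using S by (auto simp: large_jobs_def)
  have le2: "card {j \<in> ?L. S j = i} \<le> 2" if "i < c" for i
    using card_large_le_2[OF fin pos] ld that by blast
  have "card ?L = (\<Sum>i<c. card {j \<in> ?L. S j = i})"
    by (rule card_eq_sum_fibres[OF finL SL])
  \<comment> \<open>Subtraction on naturals truncates, so each core must hold at most two large jobs
    here.\<close>
  moreover have "(\<Sum>i<c. 2 - card {j \<in> ?L. S j = i}) = (\<Sum>i<c. 2) - (\<Sum>i<c. card {j \<in> ?L. S j = i})"
    by (rule sum_subtractf_nat) (use le2 in simp)
  moreover have "card ?B = 2 * c - card ?L"
    by (subst card_image) (auto simp: inj_on_def)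
  ultimately have "card ?B = (\<Sum>i<c. 2 - card {j \<in> ?L. S j = i})" by simp
  then obtain h where h: "h ` ?B \<subseteq> {..<c}"
    "\<forall>i\<in>{..<c}. card {b \<in> ?B. h b = i} = 2 - card {j \<in> ?L. S j = i}"
    using ex_fun_with_fibre_cards[OF finite_lessThan finite_imageI[OF finite_lessThan]] by blast
  define g where "g v = (case v of Job j \<Rightarrow> S j | Artificial n \<Rightarrow> h v)" for v
  define e where "e i = {v \<in> ?V. g v = i}" for i
  have V: "?V = Job ` ?L \<union> ?B" unfolding G_verts_def ..
  have gV: "g v < c" if "v \<in> ?V" for v
  proof (cases v)
    case (Job j)
    then show ?thesis using that SL by (simp add: Job_in_G_verts g_def)
  next
    case (Artificial n)
    then have "v \<in> ?B" using that unfolding V by blast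
    then have "h v < c" using h(1) by blast
    then show ?thesis by (simp add: Artificial g_def)
  qed
  have card_e: "card (e i) = 2" if "i < c" for i
  proof -
    have "v \<in> e i \<longleftrightarrow> v \<in> Job ` {j \<in> ?L. S j = i} \<union> {b \<in> ?B. h b = i}" for v
      by (cases v) (auto simp: e_def V g_def)
    then have "e i = Job ` {j \<in> ?L. S j = i} \<union> {b \<in> ?B. h b = i}" by blast
    moreover have "card (Job ` {j \<in> ?L. S j = i} \<union> {b \<in> ?B. h b = i})
        = card (Job ` {j \<in> ?L. S j = i}) + card {b \<in> ?B. h b = i}"
      by (rule card_Un_disjoint) (use finL in auto)
    moreover have "card (Job ` {j \<in> ?L. S j = i}) = card {j \<in> ?L. S j = i}"
      by (intro card_image) (auto simp: inj_on_def)
    ultimately show ?thesis using h(2) le2[OF that] that by simp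
  qed
  have we: "edge_weight (vertex_weight a) (e i) = core_load ?L a S i" for i
  proof -
    have "e i \<subseteq> ?V" unfolding e_def by blast
    moreover have "{j \<in> ?L. Job j \<in> e i} = {j \<in> ?L. S j = i}"
      unfolding e_def g_def by (auto simp: Job_in_G_verts)
    ultimately show ?thesis using edge_weight_jobs[OF fin] by (simp add: core_load_def)
  qed
  have edge: "e i \<in> G_edges J a c" if i: "i < c" for i
  proof -
    obtain u v where uv: "e i = {u, v}" "u \<noteq> v" using card_e[OF i] by (meson card_2_iff)
    then have "u \<in> ?V" "v \<in> ?V" unfolding e_def by blast+
    moreover have "edge_weight (vertex_weight a) (e i) \<le> 1"
      unfolding we using core_load_large_le[OF fin pos, of S i] ld i by fastforce
    ultimately show ?thesis using uv unfolding G_edges_def edge_weight_def by auto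
  qed
  have "perfect_matching ?V (G_edges J a c) (e ` {..<c})"
    unfolding perfect_matching_def
  proof (intro conjI ballI)
    show "e ` {..<c} \<subseteq> G_edges J a c" using edge by blast
    fix v assume v: "v \<in> ?V"
    show "\<exists>!f. f \<in> e ` {..<c} \<and> v \<in> f"
    proof (rule ex1I[of _ "e (g v)"])
      show "e (g v) \<in> e ` {..<c} \<and> v \<in> e (g v)" using gV[OF v] v unfolding e_def by auto
    qed (auto simp: e_def)
  qed
  moreover have "inj_on e {..<c}"
  proof (rule inj_onI)
    fix i k assume ik: "i \<in> {..<c}" "k \<in> {..<c}" "e i = e k"
    then have "e i \<noteq> {}" using card_e[of i] by auto
    then show "i = k" using ik(3) unfolding e_def by blast
  qed
  ultimately show ?thesis using we that by blast
qed

lemma max_demand_ge: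
  assumes "finite J" "j \<in> J"
  shows "x j \<le> max_demand J x S (S j)"
  unfolding max_demand_def using assms by (intro Max_ge) auto

lemma max_demand_nonneg:
  assumes "finite J"
  shows "0 \<le> max_demand J x S i"
  unfolding max_demand_def using assms by (intro Max_ge) auto

lemma max_demand_split:
  assumes "finite J"
  shows "max_demand J x S i
    \<le> max_demand (large_jobs J a) x S i + max_demand (small_jobs J a) x S i"
proof -
  have fin: "finite (large_jobs J a)" "finite (small_jobs J a)"
    using assms by (auto simp: large_jobs_def small_jobs_def)
  note nonneg = max_demand_nonneg[OF fin(1), of x S i] max_demand_nonneg[OF fin(2), of x S i]
  have "x j \<le> max_demand (large_jobs J a) x S i + max_demand (small_jobs J a) x S i"
    if "j \<in> J" "S j = i" for j
  proof (cases "j \<in> large_jobs J a")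
    case True
    then show ?thesis using max_demand_ge[OF fin(1), of j x S] that nonneg by simp
  next
    case False
    then have "j \<in> small_jobs J a" using that unfolding small_jobs_def by blast
    then show ?thesis using max_demand_ge[OF fin(2), of j x S] that nonneg by simp
  qed
  then show ?thesis
    using assms nonneg unfolding max_demand_def[of J] by (subst Max_le_iff) auto
qed

text \<open>Demands take the place of loads in \<open>core_load\<close>. Summed over all cores, this
  cruder bound no longer depends on the assignment.\<close>

lemma max_demand_le_core_load:
  assumes "finite J" "\<forall>j\<in>J. x j \<ge> 0"
  shows "max_demand J x S i \<le> core_load J x S i"
proof -
  have "x j \<le> core_load J x S i" if "j \<in> J" "S j = i" for j
    unfolding core_load_def using assms that by (intro member_le_sum) auto
  moreover have "0 \<le> core_load J x S i"
    unfolding core_load_def using assms by (intro sum_nonneg) auto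
  ultimately show ?thesis
    unfolding max_demand_def using assms(1) by (subst Max_le_iff) auto
qed

section \<open>The algorithm\<close>

text \<open>The first conclusion keeps the main statement about all outcomes from being vacuous; the
  second excludes failure for lack of a matching.\<close>

lemma A43_place_ex:
  assumes fin: "finite J" and pos: "\<forall>j\<in>J. a j > 0"
    and lin: "linear_order_on (G_edges J a c) r"
    and S: "\<forall>j\<in>J. S j < c" and ld: "\<forall>i<c. core_load J a S i \<le> 1"
  shows "\<exists>res. A43_place J a x c r res"
    and "\<exists>Q. dominant_perfect_matching (G_verts J a c) (G_edges J a c) (vertex_weight a) r Q"
proof -
  let ?V = "G_verts J a c" and ?w = "vertex_weight a"
  have finV: "finite ?V" using finite_G_verts[OF fin] .
  have cardL: "card (large_jobs J a) \<le> 2 * c" using card_large_jobs_le[OF fin pos S ld] .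
  obtain e where "perfect_matching ?V (G_edges J a c) (e ` {..<c})"
    using solution_matching[OF fin pos S ld] by blast
  then have "\<exists>M. perfect_matching ?V (threshold_edges ?w ?V) M" unfolding G_edges_eq by blast
  from ex_max_excess_matching[OF finV this]
  show "\<exists>Q. dominant_perfect_matching ?V (G_edges J a c) ?w r Q"
    using dominant_perfect_matching_iff_excess[OF finV lin[unfolded G_edges_eq]]
    unfolding G_edges_eq by simp
  then obtain Q where Q: "dominant_perfect_matching ?V (G_edges J a c) ?w r Q" by blast
  then have pm: "perfect_matching ?V (threshold_edges ?w ?V) Q"
    unfolding dominant_perfect_matching_def G_edges_eq by blast
  have finQ: "finite Q" using perfect_matching_finite[OF pm finV] .
  have "card Q = c"
    using card_perfect_matching[OF pm finV] card_G_verts[OF fin cardL] by simp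
  then obtain \<sigma> where \<sigma>: "bij_betw \<sigma> Q {..<c}"
    using finite_same_card_bij[OF finQ finite_lessThan, of c] by auto
  define S\<^sub>0 where "S\<^sub>0 j = \<sigma> (THE e. e \<in> Q \<and> Job j \<in> e)" for j
  have S0: "\<forall>e\<in>Q. \<forall>j. Job j \<in> e \<longrightarrow> S\<^sub>0 j = \<sigma> e"
  proof (intro ballI allI impI)
    fix e j assume e: "e \<in> Q" "Job j \<in> e"
    have "(THE e. e \<in> Q \<and> Job j \<in> e) = e"
      using e perfect_matching_unique[OF pm] by (intro the_equality) auto
    then show "S\<^sub>0 j = \<sigma> e" unfolding S\<^sub>0_def by simp
  qed
  define l where "l = core_load (large_jobs J a) a S\<^sub>0"
  have finS: "finite (small_jobs J a)" using fin unfolding small_jobs_def by simp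
  obtain ys where ys: "set ys = small_jobs J a" "distinct ys"
    using finite_distinct_list[OF finS] by blast
  define js where "js = sort_key (\<lambda>j. - x j) ys"
  define cs where "cs = sort_key l [0..<c]"
  have "sorted_wrt (\<lambda>j k. x j \<ge> x k) js"
    using sorted_sort_key[of "\<lambda>j. - x j" ys] unfolding js_def by (simp add: sorted_map)
  moreover have "sorted_wrt (\<lambda>i k. l i \<le> l k) cs"
    using sorted_sort_key[of l "[0..<c]"] unfolding cs_def by (simp add: sorted_map)
  moreover have "distinct js" "set js = small_jobs J a" unfolding js_def using ys by auto
  moreover have "distinct cs" "set cs = {..<c}" unfolding cs_def by auto
  moreover have "inj_on \<sigma> Q" "\<sigma> ` Q \<subseteq> {..<c}" using \<sigma> unfolding bij_betw_def by auto
  ultimately have "A43_place J a x c r (place_small a l cs js S\<^sub>0)"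
    using cardL Q S0 by (intro A43_place.intros[where ld = l]) (auto simp: l_def)
  then show "\<exists>res. A43_place J a x c r res" by blast
qed

text \<open>By dominance the \<open>k\<close> least loaded cores of the algorithm leave at least as much room for
  small jobs as any \<open>k\<close> cores of the given solution. The \<open>k\<close> cores preceding the core on which
  \<open>j\<close> is placed are overfull with jobs of at least the demand of \<open>j\<close>, so in the solution more
  than \<open>k\<close> cores have at least the cache that \<open>j\<close> needs.\<close>

lemma A43_place_bounds:
  assumes inst: "cache_instance J a x"
    and lin: "linear_order_on (G_edges J a c) r"
    and sol: "is_solution J x c S p" and ld1: "\<forall>i<c. core_load J a S i \<le> 1"
    and place: "A43_place J a x c r res"
  obtains S' where "res = Some S'" "\<forall>j\<in>J. S' j < c" "\<forall>i<c. core_load J a S' i \<le> 4/3"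
    "(\<Sum>i<c. max_demand J x S' i) \<le> 3 * (\<Sum>i<c. p i)"
proof -
  let ?L = "large_jobs J a" and ?T = "small_jobs J a"
  let ?V = "G_verts J a c" and ?w = "vertex_weight a"
  let ?W = "edge_weight ?w"
  have fin: "finite J" and pos: "\<forall>j\<in>J. a j > 0" and x0: "\<forall>j\<in>J. x j \<ge> 0"
    using inst unfolding cache_instance_def by auto
  have Sc: "\<forall>j\<in>J. S j < c" and Sp: "\<forall>j\<in>J. x j \<le> p (S j)" and p0: "\<forall>i<c. p i \<ge> 0"
    using sol unfolding is_solution_def by auto
  have finL: "finite ?L" and finT: "finite ?T" and finV: "finite ?V"
    using fin finite_G_verts[OF fin] by (auto simp: large_jobs_def small_jobs_def)
  have SLc: "\<forall>j\<in>?L. S j < c" using Sc by (auto simp: large_jobs_def)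
  obtain Q \<sigma> S\<^sub>0 ld js cs where
    cardL: "card ?L \<le> 2 * c" and
    Q: "dominant_perfect_matching ?V (G_edges J a c) ?w r Q" and
    \<sigma>: "inj_on \<sigma> Q" "\<sigma> ` Q \<subseteq> {..<c}" and
    S0: "\<forall>e\<in>Q. \<forall>j. Job j \<in> e \<longrightarrow> S\<^sub>0 j = \<sigma> e" and
    ld: "ld = core_load ?L a S\<^sub>0" and
    js: "distinct js" "set js = ?T" "sorted_wrt (\<lambda>j k. x j \<ge> x k) js" and
    cs: "distinct cs" "set cs = {..<c}" "sorted_wrt (\<lambda>i k. ld i \<le> ld k) cs" and
    res: "res = place_small a ld cs js S\<^sub>0"
    using place by (cases rule: A43_place.cases) blast
  have len: "length cs = c" using distinct_card[OF cs(1)] cs(2) by simp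
  have pmQ: "perfect_matching ?V (threshold_edges ?w ?V) Q"
    and exQ: "\<And>B t. perfect_matching ?V (threshold_edges ?w ?V) B \<Longrightarrow> excess ?W B t \<le> excess ?W Q t"
    using Q dominant_perfect_matching_iff_excess[OF finV lin[unfolded G_edges_eq]]
    unfolding G_edges_eq by simp_all
  obtain e where e: "inj_on e {..<c}" "perfect_matching ?V (G_edges J a c) (e ` {..<c})"
    "\<And>i. i < c \<Longrightarrow> ?W (e i) = core_load ?L a S i"
    using solution_matching[OF fin pos Sc ld1] by blast
  note pmM = e(2)[unfolded G_edges_eq]
  define m where "m = core_load ?L a S"
  have "card Q = c"
    using card_perfect_matching[OF pmQ finV] card_G_verts[OF fin cardL] by simp
  then have bij: "bij_betw \<sigma> Q {..<c}"
    unfolding bij_betw_def using \<sigma> card_subset_eq[OF finite_lessThan \<sigma>(2)]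
    by (simp add: card_image)

  have ldW: "ld (\<sigma> f) = ?W f" if f: "f \<in> Q" for f
  proof -
    have fV: "f \<subseteq> ?V"
      using f pmQ threshold_edgesE unfolding perfect_matching_def by (metis subsetD subsetI)
    have "S\<^sub>0 j = \<sigma> f \<longleftrightarrow> Job j \<in> f" if j: "j \<in> ?L" for j
    proof
      assume eq: "S\<^sub>0 j = \<sigma> f"
      have "Job j \<in> ?V" using j by (simp add: Job_in_G_verts)
      then obtain g where g: "g \<in> Q" "Job j \<in> g" using pmQ unfolding perfect_matching_def by blast
      then have "\<sigma> g = \<sigma> f" using S0 eq by simp
      then have "g = f" using \<sigma>(1) g(1) f by (simp add: inj_on_def)
      then show "Job j \<in> f" using g(2) by simp
    qed (use S0 f in blast)
    then have "{j \<in> ?L. S\<^sub>0 j = \<sigma> f} = {j \<in> ?L. Job j \<in> f}" by blast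
    then show ?thesis using edge_weight_jobs[OF fin fV] by (simp add: ld core_load_def)
  qed
  have sumQ: "(\<Sum>i<c. h (ld i)) = (\<Sum>f\<in>Q. h (?W f))" for h :: "real \<Rightarrow> real"
    using sum.reindex_bij_betw[OF bij, of "\<lambda>i. h (ld i)"] ldW by simp
  have sumM: "(\<Sum>i<c. h (m i)) = (\<Sum>f\<in>e ` {..<c}. h (?W f))" for h :: "real \<Rightarrow> real"
    using e(3) by (simp add: sum.reindex[OF e(1)] m_def)
  have summ: "(\<Sum>i<c. m i) = (\<Sum>j\<in>?L. a j)"
    unfolding m_def by (rule sum_core_load[OF finL SLc])
  have sumV: "(\<Sum>f\<in>Q. ?W f) = (\<Sum>f\<in>e ` {..<c}. ?W f)"
    unfolding edge_weight_def sum_perfect_matching[OF pmQ finV] sum_perfect_matching[OF pmM finV] ..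
  have sumld: "(\<Sum>i<c. ld i) = (\<Sum>i<c. m i)"
    using sumQ[of "\<lambda>y. y"] sumM[of "\<lambda>y. y"] sumV by simp
  \<comment> \<open>The passage from heavy to light cores: room below \<open>t\<close> equals the
    excess over \<open>t\<close> plus \<open>c * t\<close> minus the total load, and the totals of
    \<open>ld\<close> and \<open>m\<close> agree.\<close>
  have room: "(\<Sum>i<c. max 0 (t - m i)) \<le> (\<Sum>i<c. max 0 (t - ld i))" for t
  proof -
    have "max 0 (t - y) = max 0 (y - t) + t - y" for y :: real by simp
    then have "(\<Sum>i<c. max 0 (t - f i)) = (\<Sum>i<c. max 0 (f i - t)) + c * t - (\<Sum>i<c. f i)"
      for f :: "nat \<Rightarrow> real"
      by (simp add: sum.distrib sum_subtractf)
    moreover have "(\<Sum>i<c. max 0 (m i - t)) \<le> (\<Sum>i<c. max 0 (ld i - t))"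
      using exQ[OF pmM, of t] sumQ[of "\<lambda>y. max 0 (y - t)"] sumM[of "\<lambda>y. max 0 (y - t)"]
      unfolding excess_def by linarith
    ultimately show ?thesis using sumld by simp
  qed
  have ld_le_1: "ld i \<le> 1" if i: "i < c" for i
  proof -
    obtain f where f: "f \<in> Q" "i = \<sigma> f" using bij i unfolding bij_betw_def by blast
    then have "f \<in> threshold_edges ?w ?V" using pmQ unfolding perfect_matching_def by blast
    then have "?W f \<le> 1" unfolding threshold_edges_def edge_weight_def by auto
    then show ?thesis using ldW f by simp
  qed

  \<comment> \<open>Failure would require a total load above \<open>c\<close>, but the solution fits
    all jobs on \<open>c\<close> cores of load at most 1.\<close>
  have "res \<noteq> None"
  proof
    assume None: "res = None"
    have "\<forall>j\<in>set js. a j > 0" using js(2) pos by (auto simp: small_jobs_def)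
    from place_small_None[OF None[unfolded res] cs(1) this]
    have "c < (\<Sum>i<c. ld i) + (\<Sum>j\<in>?T. a j)"
      using len cs js by (simp add: sum_list_distinct_conv_sum_set)
    also have "\<dots> = (\<Sum>j\<in>?L. a j) + (\<Sum>j\<in>?T. a j)" using sumld summ by simp
    also have "\<dots> = (\<Sum>j\<in>J. a j)"
      using sum.subset_diff[OF large_jobs_subset[of J a] fin, of a] by (simp add: small_jobs_def)
    also have "\<dots> = (\<Sum>i<c. core_load J a S i)" by (rule sum_core_load[OF fin Sc, symmetric])
    also have "\<dots> \<le> (\<Sum>i<c. 1)" using ld1 by (intro sum_mono) auto
    finally show False by simp
  qed
  then obtain S' where S': "res = Some S'" by blast
  note pl = S'[unfolded res]
  note cores = place_small_cores[OF pl js(1)]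
  have S'L: "S' j = S\<^sub>0 j" if "j \<in> ?L" for j
    using cores[of j] that js(2) by (simp add: small_jobs_def)

  have assigned: "\<forall>j\<in>J. S' j < c"
  proof
    fix j assume j: "j \<in> J"
    show "S' j < c"
    proof (cases "j \<in> ?L")
      case True
      then have "Job j \<in> ?V" by (simp add: Job_in_G_verts)
      then obtain g where g: "g \<in> Q" "Job j \<in> g" using pmQ unfolding perfect_matching_def by blast
      then show ?thesis using S0 S'L[OF True] \<sigma>(2) by auto
    next
      case False
      then have "j \<in> set js" using j js(2) by (simp add: small_jobs_def)
      then show ?thesis using cores[of j] cs(2) by simp
    qed
  qed

  have loads: "\<forall>i<c. core_load J a S' i \<le> 4/3"
  proof (intro allI impI)
    fix i assume i: "i < c"
    have "\<forall>j\<in>set js. a j \<le> 1/3" using js(2) by (auto simp: small_jobs_def large_jobs_def)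
    from place_small_load[OF pl js(1) this, of i]
    have "ld i + core_load ?T a S' i \<le> 4/3"
      using ld_le_1[OF i] js(2) by (simp add: core_load_def)
    moreover have "core_load ?L a S' i = ld i"
      unfolding ld core_load_def using S'L by (intro sum.cong) auto
    ultimately show "core_load J a S' i \<le> 4/3"
      using core_load_split[OF fin, of a S' i] by simp
  qed

  have many: "k < card {i \<in> {..<c}. max_demand ?T x S' (cs ! k) \<le> p i}" if k: "k < c" for k
  proof -
    let ?d = "max_demand ?T x S' (cs ! k)"
    have "?d \<in> insert 0 (x ` {j \<in> ?T. S' j = cs ! k})"
      unfolding max_demand_def using finT by (intro Max_in) auto
    then consider "?d = 0" | j where "?d = x j" "j \<in> ?T" "S' j = cs ! k" by auto
    then show ?thesis
    proof cases
      \<comment> \<open>This includes a core without small jobs, where \<open>max_demand\<close> has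
        its default 0.\<close>
      case 1
      then have "{i \<in> {..<c}. ?d \<le> p i} = {..<c}" using p0 by auto
      then show ?thesis using k by simp
    next
      case (2 j)
      define N where "N = {i \<in> {..<c}. x j \<le> p i}"
      define Y where "Y = {y \<in> ?T. x j \<le> x y}"
      define P where "P = set (take k cs)"
      have finN: "finite N" and finY: "finite Y" unfolding N_def Y_def using finT by auto
      have P: "P \<subseteq> {..<c}" unfolding P_def using cs(2) set_take_subset by metis
      then have finP: "finite P" using finite_subset by blast
      have cardP: "card P = k"
        unfolding P_def using k len cs(1) by (simp add: distinct_card)
      have "\<not> card N \<le> k"
      proof
        assume Nk: "card N \<le> k"
        \<comment> \<open>The load of the core of \<open>j\<close> before the small jobs separates
          the cores of \<open>P\<close> from all others, so the room of the algorithm below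
          \<open>t\<close> lies entirely on \<open>P\<close>. The chain below thus returns to the
          sum it starts from, against its strict first step.\<close>
        define t where "t = ld (cs ! k)"
        have "cs ! k < c" using k len cs(2) nth_mem by blast
        then have t1: "t \<le> 1" unfolding t_def by (rule ld_le_1)
        have above: "t \<le> ld i" if i: "i \<in> {..<c} - P" for i
        proof -
          obtain n where n: "n < c" "i = cs ! n"
            using i cs(2) len by (metis DiffD1 in_set_conv_nth)
          have "\<not> n < k" using i n k len unfolding P_def by (auto simp: in_set_conv_nth)
          then show ?thesis
            using n cs(3) len unfolding t_def by (cases "n = k") (auto simp: sorted_wrt_iff_nth_less)
        qed
        have below: "ld i \<le> t" if i: "i \<in> P" for i
        proof -
          obtain n where "n < k" "i = cs ! n"
            using i k len unfolding P_def by (auto simp: in_set_conv_nth)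
          then show ?thesis
            using cs(3) k len unfolding t_def by (auto simp: sorted_wrt_iff_nth_less)
        qed
        have posjs: "\<forall>j\<in>set js. a j > 0" using js(2) pos by (auto simp: small_jobs_def)
        have jk: "j \<in> set js" "k < length cs" using 2 js(2) k len by auto
        have "(\<Sum>i\<in>P. 1 - ld i) < (\<Sum>y\<in>Y. a y)"
          using place_small_prefix_load[OF pl cs(1) js(1) posjs js(3) jk 2(3)]
            sum_list_distinct_conv_sum_set[of "take k cs" "\<lambda>i. 1 - ld i"]
            sum_list_distinct_conv_sum_set[of "filter (\<lambda>y. x j \<le> x y) js" a] cs(1) js(1,2)
          unfolding P_def Y_def by simp
        \<comment> \<open>The solution can serve jobs of demand at least \<open>x j\<close> only on
          cores in \<open>N\<close>.\<close>
        also have "\<dots> = (\<Sum>i\<in>N. \<Sum>y\<in>{y \<in> Y. S y = i}. a y)"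
        proof (rule sum.group[symmetric, OF finY finN])
          show "S ` Y \<subseteq> N"
          proof
            fix i assume "i \<in> S ` Y"
            then obtain y where y: "y \<in> J" "x j \<le> x y" "i = S y"
              unfolding Y_def small_jobs_def by blast
            then have "x y \<le> p (S y)" "S y < c" using Sp Sc by auto
            then show "i \<in> N" using y unfolding N_def by auto
          qed
        qed
        also have "\<dots> \<le> (\<Sum>i\<in>N. 1 - m i)"
        proof (rule sum_mono)
          fix i assume "i \<in> N"
          then have i: "i < c" unfolding N_def by simp
          have "(\<Sum>y\<in>{y \<in> Y. S y = i}. a y) \<le> core_load ?T a S i"
            unfolding core_load_def
            by (rule sum_mono2) (use fin pos in \<open>auto simp: Y_def small_jobs_def intro: less_imp_le\<close>)
          also have "\<dots> \<le> 1 - m i"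
            using core_load_split[OF fin, of a S i] ld1 i unfolding m_def by fastforce
          finally show "(\<Sum>y\<in>{y \<in> Y. S y = i}. a y) \<le> 1 - m i" .
        qed
        \<comment> \<open>Splitting at \<open>t\<close> lets \<open>card N\<close> be raised to
          \<open>k\<close>, as \<open>1 - t\<close> is nonnegative, and turns the rest into the form
          bounded by \<open>room\<close>.\<close>
        also have "\<dots> = card N * (1 - t) + (\<Sum>i\<in>N. t - m i)"
          by (simp add: sum_subtractf algebra_simps)
        also have "\<dots> \<le> k * (1 - t) + (\<Sum>i<c. max 0 (t - m i))"
        proof (rule add_mono)
          show "card N * (1 - t) \<le> k * (1 - t)" using Nk t1 by (intro mult_right_mono) auto
          have "(\<Sum>i\<in>N. t - m i) \<le> (\<Sum>i\<in>N. max 0 (t - m i))" by (rule sum_mono) simp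
          also have "\<dots> \<le> (\<Sum>i<c. max 0 (t - m i))"
            by (rule sum_mono2) (auto simp: N_def)
          finally show "(\<Sum>i\<in>N. t - m i) \<le> (\<Sum>i<c. max 0 (t - m i))" .
        qed
        also have "\<dots> \<le> k * (1 - t) + (\<Sum>i<c. max 0 (t - ld i))" using room by simp
        also have "(\<Sum>i<c. max 0 (t - ld i)) = (\<Sum>i\<in>P. max 0 (t - ld i))"
          by (rule sum.mono_neutral_right) (use P above in auto)
        also have "\<dots> = (\<Sum>i\<in>P. t - ld i)"
          by (rule sum.cong) (use below in auto)
        also have "k * (1 - t) + (\<Sum>i\<in>P. t - ld i) = (\<Sum>i\<in>P. 1 - ld i)"
          using cardP by (simp add: sum_subtractf algebra_simps)
        finally show False by simp
      qed
      then show ?thesis using 2(1) unfolding N_def by simp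
    qed
  qed
  have "(\<Sum>i<c. max_demand ?T x S' i) = (\<Sum>k<c. max_demand ?T x S' (cs ! k))"
    by (rule sum.reindex_bij_betw[symmetric], rule bij_betw_nth) (use cs len in auto)
  also have "\<dots> \<le> (\<Sum>i<c. p i)"
    by (rule sum_le_of_many_above[OF finite_lessThan]) (use p0 many in auto)
  finally have small: "(\<Sum>i<c. max_demand ?T x S' i) \<le> (\<Sum>i<c. p i)" .

  \<comment> \<open>Through the total demand of the large jobs the bound passes from
    \<open>S'\<close> to \<open>S\<close>, where core \<open>i\<close> holds at most two of them,
    each demanding at most \<open>p i\<close>.\<close>
  have "(\<Sum>i<c. max_demand ?L x S' i) \<le> (\<Sum>i<c. core_load ?L x S' i)"
    by (intro sum_mono max_demand_le_core_load finL) (use x0 in \<open>auto simp: large_jobs_def\<close>)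
  also have "\<dots> = (\<Sum>j\<in>?L. x j)"
    by (rule sum_core_load[OF finL]) (use assigned in \<open>auto simp: large_jobs_def\<close>)
  also have "\<dots> = (\<Sum>i<c. core_load ?L x S i)"
    by (rule sum_core_load[OF finL SLc, symmetric])
  also have "\<dots> \<le> (\<Sum>i<c. 2 * p i)"
  proof (rule sum_mono)
    fix i assume "i \<in> {..<c}"
    then have i: "i < c" by simp
    have "core_load ?L x S i \<le> (\<Sum>j | j \<in> ?L \<and> S j = i. p i)"
      unfolding core_load_def by (rule sum_mono) (use Sp in \<open>auto simp: large_jobs_def\<close>)
    also have "\<dots> = card {j \<in> ?L. S j = i} * p i" by simp
    also have "\<dots> \<le> 2 * p i"
      using card_large_le_2[OF fin pos, of S i] ld1 i p0 by (intro mult_right_mono) auto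
    finally show "core_load ?L x S i \<le> 2 * p i" .
  qed
  finally have large: "(\<Sum>i<c. max_demand ?L x S' i) \<le> 2 * (\<Sum>i<c. p i)"
    by (simp add: sum_distrib_left)

  have "(\<Sum>i<c. max_demand J x S' i)
      \<le> (\<Sum>i<c. max_demand ?L x S' i) + (\<Sum>i<c. max_demand ?T x S' i)"
    unfolding sum.distrib[symmetric] by (intro sum_mono max_demand_split fin)
  then have "(\<Sum>i<c. max_demand J x S' i) \<le> 3 * (\<Sum>i<c. p i)"
    using small large by simp
  then show ?thesis using that S' assigned loads by blast
qed

theorem theorem7:
  fixes J :: "'j set" and a x :: "'j \<Rightarrow> real" and c :: nat and K :: real
    and r :: "'j vertex set rel"
  assumes "cache_instance J a x"
    and "linear_order_on (G_edges J a c) r"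
    and "\<exists>S p. is_solution J x c S p \<and> makespan J a c S \<le> 1 \<and> cache_used c p \<le> K"
  shows "(\<exists>res. A43 J a x c K r res) \<and>
         (\<forall>res. A43 J a x c K r res \<longrightarrow>
            (\<exists>S p. res = Some (S, p) \<and> is_solution J x c S p \<and>
                   makespan J a c S \<le> 4/3 \<and> cache_used c p \<le> 3 * K))"
proof -
  obtain S p where sol: "is_solution J x c S p" "makespan J a c S \<le> 1" "cache_used c p \<le> K"
    using assms(3) by blast
  have fin: "finite J" and pos: "\<forall>j\<in>J. a j > 0"
    using assms(1) unfolding cache_instance_def by auto
  have Sc: "\<forall>j\<in>J. S j < c" using sol(1) unfolding is_solution_def by auto
  have ld: "\<forall>i<c. core_load J a S i \<le> 1"
    using sol(2) unfolding makespan_def by simp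
  note ex = A43_place_ex[OF fin pos assms(2) Sc ld]
  have good: "\<exists>S'. res = Some S' \<and> is_solution J x c S' (max_demand J x S') \<and>
      makespan J a c S' \<le> 4/3 \<and> cache_used c (max_demand J x S') \<le> 3 * K"
    if place: "A43_place J a x c r res" for res
  proof -
    obtain S' where S': "res = Some S'" "\<forall>j\<in>J. S' j < c" "\<forall>i<c. core_load J a S' i \<le> 4/3"
      "(\<Sum>i<c. max_demand J x S' i) \<le> 3 * (\<Sum>i<c. p i)"
      using A43_place_bounds[OF assms(1,2) sol(1) ld place] by blast
    have "is_solution J x c S' (max_demand J x S')"
      using S'(2) max_demand_nonneg[OF fin] max_demand_ge[OF fin] unfolding is_solution_def by blast
    moreover have "makespan J a c S' \<le> 4/3" using S'(3) unfolding makespan_def by (intro Max.boundedI) auto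
    moreover have "cache_used c (max_demand J x S') \<le> 3 * K"
      using S'(4) sol(3) unfolding cache_used_def by simp
    ultimately show ?thesis using S'(1) by blast
  qed
  show ?thesis
  proof (intro conjI allI impI)
    obtain res where res: "A43_place J a x c r res" using ex(1) by blast
    with good obtain S' where "res = Some S'" "cache_used c (max_demand J x S') \<le> 3 * K" by blast
    then show "\<exists>res. A43 J a x c K r res" using A43.success res by metis
  next
    fix res assume "A43 J a x c K r res"
    then show "\<exists>S p. res = Some (S, p) \<and> is_solution J x c S p \<and>
        makespan J a c S \<le> 4/3 \<and> cache_used c p \<le> 3 * K"
    proof cases
      case too_many_large
      then show ?thesis using card_large_jobs_le[OF fin pos Sc ld] by simp
    next
      case no_matching
      then show ?thesis using ex(2) by blast
    next
      case too_many_cores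
      then show ?thesis using good[of None] by simp
    next
      case (too_much_cache S')
      then show ?thesis using good[of "Some S'"] by simp
    next
      case (success S')
      then show ?thesis using good[of "Some S'"] by simp
    qed
  qed
qed

end
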